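(* Let $D(z)=\sum_{j\in E}d_j z^{k_j}\in\mathcal{L}$, where $d_j\in\mathcal{L}_\downarrow$, $d_jz^{k_j}\in\mathcal{L}_\downarrow z^j$ and $k_j\in\mathbb{Z}^d$. Suppose that $d_0\neq 0$ is invertible in $\mathcal{L}_\downarrow(\ell_1)$ (i.e. $d_0\ne 0$ has no zeros on the unit torus $\mathbb{T}^d$). Let $D_j(z)=d_j-d_0z^{-k_j}$ and $H_j(z)=\overline{D_j(z)}=\overline{d_j}-\overline{d_0}\,z^{k_j}$, where $j\in E\setminus\{0\}$. Then: (i) $\rho(D(z)D_j(z))=\rho(\overline{D(z)}H_j(z))=0$ for any $j\in E\setminus\{0\}$; (ii) the polynomials $H_j(z)$, $j\in E\setminus\{0\}$, are linearly independent over $\mathcal{L}_\downarrow(\ell_1)$; (iii) the elements $H_j(z)$, $j\in E\setminus\{0\}$, form a basis of $\operatorname{Ker}\rho_D$ over $\mathcal{L}_\downarrow(\ell_1)$; (iv) if $H(z)\in\mathcal{L}$ is a polynomial such that $\rho_D(H(z))$ is invertible in $\mathcal{L}_\downarrow(\ell_1)$, then the polynomials $\{H_j(z) : j\in E\setminus\{0\}\}$ and $H(z)$ form a basis of $\mathcal{L}(\ell_1)$ over $\mathcal{L}_\downarrow(\ell_1)$.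
   Context: Let $d\ge1$, $E=\{0,1\}^d$, $\mathbb{T}^d=\{z\in\mathbb{C}^d:|z_j|=1,\ j=1,\dots,d\}$, $z^k=z_1^{k_1}\cdots z_d^{k_d}$ for $k\in\mathbb{Z}^d$. $\mathcal{L}$ is the ring of Laurent polynomials $\sum_{k\in M}a_kz^k$ ($M\subset\mathbb{Z}^d$ finite, $a_k\in\mathbb{C}$), and $\mathcal{L}(\ell_1)$ is the commutative ring of Laurent series $\sum_{k\in\mathbb{Z}^d}a_kz^k$ with $a\in\ell_1(\mathbb{Z}^d)$, considered as functions on $\mathbb{T}^d$. Subrings: $\mathcal{L}_\downarrow=\{P(z^2):P\in\mathcal{L}\}$ and $\mathcal{L}_\downarrow(\ell_1)=\{F(z^2):F\in\mathcal{L}(\ell_1)\}$, where $z^2=(z_1^2,\dots,z_d^2)$. $\mathcal{L}(\ell_1)$ is a free $\mathcal{L}_\downarrow(\ell_1)$-module with basis $z^j$, $j\in E$. Conjugation: $\overline{\sum a_kz^k}=\sum\overline{a_k}z^{-k}$. The map $\rho:\mathcal{L}(\ell_1)\to\mathcal{L}_\downarrow(\ell_1)$ sends $A=\sum_{j\in E}a_jz^j$ (unique $a_j\in\mathcal{L}_\downarrow(\ell_1)$) to $a_0$; equivalently $\rho(A)(z)=2^{-d}\sum_{s\in E}A((-1)^sz)$ with $(-1)^sz=((-1)^{s_1}z_1,\dots,(-1)^{s_d}z_d)$. For $D\in\mathcal{L}$, $\rho_D:\mathcal{L}(\ell_1)\to\mathcal{L}_\downarrow(\ell_1)$ is $\rho_D(F)=\rho(D\,\overline{F})$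 and $\operatorname{Ker}\rho_D=\{F\in\mathcal{L}(\ell_1):\rho_D(F)=0\}$.
   Formalization: The formal version assumes k_0 = 0, and that z^{k_j} lies in L_down z^j also when d_j = 0; without these, (i) fails, e.g. for d = 1, D = z^2 + z with d_0 = d_1 = 1, k_0 = 2, k_1 = 1, or for D = 1 with d_1 = 0, k_1 = 0. *)

theory Defs
  imports "HOL-Analysis.Analysis" "HOL-Library.Function_Algebras"
begin

text \<open>
  The dimension \<open>d\<close> is \<open>CARD('n)\<close> for a type \<open>'n\<close> of class \<open>finite\<close> (so \<open>d \<ge> 1\<close>), and exponents
  are elements of \<open>int ^ 'n\<close>. Laurent series are functions on the torus, so they live in the
  commutative ring \<open>'n torus \<Rightarrow> complex\<close> with the pointwise operations of
  \<^theory>\<open>HOL-Library.Function_Algebras\<close>.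
\<close>

typedef (overloaded) 'n torus = "{z :: complex ^ 'n::finite. \<forall>i. norm (z $ i) = 1}"
  by (rule exI[of _ "\<chi> i. 1"]) simp

definition zpow :: "int ^ 'n::finite \<Rightarrow> 'n torus \<Rightarrow> complex" where
  "zpow k = (\<lambda>z. \<Prod>i\<in>UNIV. (Rep_torus z $ i) powi (k $ i))"

definition cube :: "(int ^ 'n::finite) set" where
  "cube = {j. \<forall>i. j $ i \<in> {0, 1}}"

definition laurent_series :: "(int ^ 'n::finite \<Rightarrow> complex) \<Rightarrow> 'n torus \<Rightarrow> complex" where
  "laurent_series a = (\<lambda>z. \<Sum>\<^sub>\<infinity>k. a k * zpow k z)"

definition LP :: "('n::finite torus \<Rightarrow> complex) set" where
  "LP = {F. \<exists>M a. finite M \<and> F = (\<lambda>z. \<Sum>k\<in>M. a k * zpow k z)}"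

definition Ll1 :: "('n::finite torus \<Rightarrow> complex) set" where
  "Ll1 = {F. \<exists>a. (\<lambda>k. norm (a k)) summable_on UNIV \<and> F = laurent_series a}"

definition torus_sq :: "'n::finite torus \<Rightarrow> 'n torus" where
  "torus_sq z = Abs_torus (\<chi> i. (Rep_torus z $ i)\<^sup>2)"

definition LP_down :: "('n::finite torus \<Rightarrow> complex) set" where
  "LP_down = {F. \<exists>P\<in>LP. F = (\<lambda>z. P (torus_sq z))}"

definition Ll1_down :: "('n::finite torus \<Rightarrow> complex) set" where
  "Ll1_down = {F. \<exists>G\<in>Ll1. F = (\<lambda>z. G (torus_sq z))}"

text \<open>
  Conjugation is given on coefficients. The choice of the coefficients of \<open>F\<close> is immaterial: by
  the lemma \<open>lconj_eq_cnj\<close> below, the result is always the pointwise conjugate of \<open>F\<close>.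
\<close>

definition lconj :: "('n::finite torus \<Rightarrow> complex) \<Rightarrow> 'n torus \<Rightarrow> complex" where
  "lconj F = (let a = (SOME a. (\<lambda>k. norm (a k)) summable_on UNIV \<and> F = laurent_series a)
              in laurent_series (\<lambda>k. cnj (a (- k))))"

text \<open>
  \<open>rho A\<close> is the coefficient of \<open>zpow 0 = 1\<close> in the expansion of \<open>A\<close> with respect to the basis
  \<open>zpow j\<close>, \<open>j \<in> cube\<close>; it is well defined on \<open>Ll1\<close> by \<open>parity_decomposition\<close> and \<open>rho_eqI\<close> below.
\<close>

definition rho :: "('n::finite torus \<Rightarrow> complex) \<Rightarrow> 'n torus \<Rightarrow> complex" where
  "rho A = (THE b. \<exists>a. (\<forall>j\<in>cube. a j \<in> Ll1_down) \<and> A = (\<Sum>j\<in>cube. a j * zpow j) \<and> b = a 0)"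

definition rhoD ::
    "('n::finite torus \<Rightarrow> complex) \<Rightarrow> ('n torus \<Rightarrow> complex) \<Rightarrow> 'n torus \<Rightarrow> complex" where
  "rhoD D F = rho (D * lconj F)"

definition Ker_rhoD :: "('n::finite torus \<Rightarrow> complex) \<Rightarrow> ('n torus \<Rightarrow> complex) set" where
  "Ker_rhoD D = {F \<in> Ll1. rhoD D F = 0}"

definition invertible_in :: "'a::comm_ring_1 set \<Rightarrow> 'a \<Rightarrow> bool" where
  "invertible_in R u \<longleftrightarrow> u \<in> R \<and> (\<exists>v\<in>R. u * v = 1)"

text \<open>
  Linear independence and bases of finite families over a subring \<open>R\<close>, for \<open>R\<close>-submodules \<open>N\<close> of
  the ambient ring. The set \<open>N\<close> is required to be equal to the span, so the members of a basis
  of \<open>N\<close> belong to \<open>N\<close>.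
\<close>

definition lin_indep_over :: "'a::comm_ring_1 set \<Rightarrow> 'i set \<Rightarrow> ('i \<Rightarrow> 'a) \<Rightarrow> bool" where
  "lin_indep_over R I v \<longleftrightarrow> finite I \<and>
     (\<forall>c. (\<forall>i\<in>I. c i \<in> R) \<and> (\<Sum>i\<in>I. c i * v i) = 0 \<longrightarrow> (\<forall>i\<in>I. c i = 0))"

definition span_over :: "'a::comm_ring_1 set \<Rightarrow> 'i set \<Rightarrow> ('i \<Rightarrow> 'a) \<Rightarrow> 'a set" where
  "span_over R I v = {x. \<exists>c. (\<forall>i\<in>I. c i \<in> R) \<and> x = (\<Sum>i\<in>I. c i * v i)}"

definition basis_over :: "'a::comm_ring_1 set \<Rightarrow> 'a set \<Rightarrow> 'i set \<Rightarrow> ('i \<Rightarrow> 'a) \<Rightarrow> bool" where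
  "basis_over R N I v \<longleftrightarrow> lin_indep_over R I v \<and> span_over R I v = N"


section \<open>Well-definedness\<close>

lemma norm_Rep_torus [simp]: "norm (Rep_torus z $ i) = 1"
  using Rep_torus[of z] by simp

lemma Rep_torus_nz [simp]: "Rep_torus z $ i \<noteq> 0"
  using norm_Rep_torus[of z i] by (metis norm_zero zero_neq_one)

lemma Rep_torus_sq: "Rep_torus (torus_sq z) = (\<chi> i. (Rep_torus z $ i)\<^sup>2)"
  unfolding torus_sq_def by (rule Abs_torus_inverse) (simp add: norm_power)

lemma norm_zpow [simp]: "norm (zpow k z) = 1"
  by (simp add: zpow_def prod_norm[symmetric] norm_power_int)

lemma zpow_0: "zpow 0 = 1"
  by (rule ext) (simp add: zpow_def)

lemma zpow_add: "zpow (k + l) z = zpow k z * zpow l z"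
  by (simp add: zpow_def power_int_add prod.distrib)

lemma zpow_sq: "zpow k (torus_sq z) = zpow (k + k) z"
  unfolding zpow_add
  by (simp add: zpow_def Rep_torus_sq power2_eq_square power_int_mult_distrib prod.distrib)

lemma cnj_zpow: "cnj (zpow k z) = zpow (- k) z"
proof -
  have "cnj (Rep_torus z $ i) = inverse (Rep_torus z $ i)" for i
    using complex_norm_square[of "Rep_torus z $ i"]
    by (intro inverse_unique[symmetric]) simp
  then show ?thesis by (simp add: zpow_def power_int_minus power_int_inverse)
qed

lemma finite_cube: "finite (cube :: (int ^ 'n::finite) set)"
proof -
  have "cube \<subseteq> (\<lambda>f. \<chi> i. f i) ` (PiE (UNIV :: 'n set) (\<lambda>_. {0, 1 :: int}))"
  proof
    fix j :: "int ^ 'n" assume "j \<in> cube"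
    then show "j \<in> (\<lambda>f. \<chi> i. f i) ` (PiE (UNIV :: 'n set) (\<lambda>_. {0, 1 :: int}))"
      by (intro image_eqI[of _ _ "\<lambda>i. j $ i"]) (auto simp: cube_def)
  qed
  then show ?thesis by (rule finite_subset) (intro finite_imageI finite_PiE; simp)
qed

lemma zero_in_cube: "0 \<in> cube"
  by (simp add: cube_def)

lemma laurent_summable:
  assumes "(\<lambda>k. norm (a k)) summable_on UNIV"
  shows "(\<lambda>k. norm (a k * zpow k z)) summable_on UNIV"
  using assms by (simp add: norm_mult)

lemma sum_fun_apply: "(\<Sum>i\<in>I. f i) z = (\<Sum>i\<in>I. (f i z :: complex))"
  by (induction I rule: infinite_finite_induct) auto

lemma cnj_laurent_series:
  "laurent_series (\<lambda>k. cnj (a (- k))) z = cnj (laurent_series a z)"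
proof -
  have "laurent_series (\<lambda>k. cnj (a (- k))) z = (\<Sum>\<^sub>\<infinity>k. cnj (a (- k) * zpow (- k) z))"
    by (simp add: laurent_series_def cnj_zpow)
  also have "\<dots> = (\<Sum>\<^sub>\<infinity>k. cnj (a k * zpow k z))"
    by (rule infsum_reindex_bij_witness[of _ uminus uminus]) auto
  finally show ?thesis by (simp only: infsum_cnj laurent_series_def)
qed

lemma lconj_eq_cnj:
  assumes "F \<in> Ll1"
  shows "lconj F = (\<lambda>z. cnj (F z))"
proof -
  define a where "a = (SOME a. (\<lambda>k. norm (a k)) summable_on UNIV \<and> F = laurent_series a)"
  have "\<exists>a. (\<lambda>k. norm (a k)) summable_on UNIV \<and> F = laurent_series a"
    using assms by (simp add: Ll1_def)
  from someI_ex[OF this] have "F = laurent_series a"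
    unfolding a_def by (rule conjunct2)
  have "lconj F = laurent_series (\<lambda>k. cnj (a (- k)))"
    by (simp only: lconj_def Let_def a_def)
  also have "\<dots> = (\<lambda>z. cnj (F z))"
    by (rule ext) (simp only: cnj_laurent_series \<open>F = laurent_series a\<close>[symmetric])
  finally show ?thesis .
qed

definition torus_sign :: "int ^ 'n::finite \<Rightarrow> 'n torus \<Rightarrow> 'n torus" where
  "torus_sign s z = Abs_torus (\<chi> i. (- 1) powi (s $ i) * Rep_torus z $ i)"

lemma Rep_torus_sign: "Rep_torus (torus_sign s z) = (\<chi> i. (- 1) powi (s $ i) * Rep_torus z $ i)"
  unfolding torus_sign_def by (rule Abs_torus_inverse) (simp add: norm_mult norm_power_int)

lemma torus_sq_sign: "torus_sq (torus_sign s z) = torus_sq z"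
proof -
  have "((- 1 :: complex) powi m)\<^sup>2 = 1" for m
    by (cases "even m") auto
  then show ?thesis
    by (simp add: torus_sq_def Rep_torus_sign power_mult_distrib)
qed

lemma Ll1_down_sign:
  assumes "F \<in> Ll1_down"
  shows "F (torus_sign s z) = F z"
  using assms by (auto simp: Ll1_down_def torus_sq_sign)

lemma zpow_sign:
  "zpow j (torus_sign s z) = (\<Prod>i\<in>UNIV. ((- 1) powi (s $ i)) powi (j $ i)) * zpow j z"
  by (simp add: zpow_def Rep_torus_sign power_int_mult_distrib prod.distrib)

lemma sum_cube_prod:
  fixes g :: "'n::finite \<Rightarrow> complex"
  shows "(\<Sum>s\<in>cube. \<Prod>i\<in>UNIV. g i powi (s $ i)) = (\<Prod>i\<in>UNIV. g i + 1)"
proof -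
  have "(\<Prod>i\<in>UNIV. g i + 1) = (\<Sum>X\<in>Pow UNIV. (\<Prod>i\<in>X. g i) * (\<Prod>i\<in>UNIV - X. 1))"
    by (rule prod_add) simp
  also have "\<dots> = (\<Sum>s\<in>cube. \<Prod>i\<in>UNIV. g i powi (s $ i))"
  proof (rule sum.reindex_bij_witness[of _ "\<lambda>s. {i. s $ i = 1}" "\<lambda>X. \<chi> i. if i \<in> X then 1 else 0"],
      goal_cases)
    case (4 s) then show ?case by (auto simp: cube_def vec_eq_iff)
  next
    case (5 X)
    have "(\<Prod>i\<in>UNIV. g i powi ((\<chi> i. if i \<in> X then 1 else 0) $ i)) = (\<Prod>i\<in>UNIV. if i \<in> X then g i else 1)"
      by (intro prod.cong) auto
    then show ?case by (simp add: prod.If_cases)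
  qed (auto simp: cube_def vec_eq_iff)
  finally show ?thesis by simp
qed

lemma sum_cube_character:
  fixes j :: "int ^ 'n::finite"
  assumes "j \<in> cube"
  shows "(\<Sum>s\<in>cube. \<Prod>i\<in>UNIV. ((- 1 :: complex) powi (s $ i)) powi (j $ i)) =
    (if j = 0 then 2 ^ CARD('n) else 0)"
proof -
  have "(\<Sum>s\<in>cube. \<Prod>i\<in>UNIV. ((- 1 :: complex) powi (s $ i)) powi (j $ i)) =
      (\<Sum>s\<in>cube. \<Prod>i\<in>UNIV. ((- 1 :: complex) powi (j $ i)) powi (s $ i))"
    by (simp add: power_int_mult[symmetric] mult.commute)
  also have "\<dots> = (\<Prod>i\<in>UNIV. (- 1 :: complex) powi (j $ i) + 1)"
    by (rule sum_cube_prod)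
  also have "\<dots> = (if j = 0 then 2 ^ CARD('n) else 0)"
  proof (cases "j = 0")
    case False
    then obtain i where "j $ i = 1" using assms by (auto simp: cube_def vec_eq_iff)
    then have "\<exists>i. (- 1 :: complex) powi (j $ i) + 1 = 0" by (intro exI[of _ i]) simp
    then show ?thesis using False by simp
  qed simp
  finally show ?thesis .
qed

lemma component_0_eq_average:
  fixes A :: "'n::finite torus \<Rightarrow> complex"
  assumes "\<forall>j\<in>cube. a j \<in> Ll1_down" and "A = (\<Sum>j\<in>cube. a j * zpow j)"
  shows "a 0 = (\<lambda>z. (\<Sum>s\<in>cube. A (torus_sign s z)) / 2 ^ CARD('n))"
proof
  fix z
  have "(\<Sum>s\<in>cube. A (torus_sign s z)) =
      (\<Sum>s\<in>cube. \<Sum>j\<in>cube. a j z * ((\<Prod>i\<in>UNIV. ((- 1) powi (s $ i)) powi (j $ i)) * zpow j z))"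
    using assms(1) by (simp add: assms(2) sum_fun_apply zpow_sign Ll1_down_sign)
  also have "\<dots> = (\<Sum>j\<in>cube. \<Sum>s\<in>cube. a j z * ((\<Prod>i\<in>UNIV. ((- 1) powi (s $ i)) powi (j $ i)) * zpow j z))"
    by (rule sum.swap)
  also have "\<dots> = (\<Sum>j\<in>cube. a j z * zpow j z * (\<Sum>s\<in>cube. \<Prod>i\<in>UNIV. ((- 1) powi (s $ i)) powi (j $ i)))"
    by (simp add: sum_distrib_left mult_ac)
  also have "\<dots> = (\<Sum>j\<in>(cube :: (int ^ 'n) set). if j = 0 then a 0 z * 2 ^ CARD('n) else 0)"
    by (rule sum.cong[OF refl]) (simp add: sum_cube_character zpow_0)
  also have "\<dots> = a 0 z * 2 ^ CARD('n)"
    by (simp add: finite_cube zero_in_cube)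
  finally show "a 0 z = (\<Sum>s\<in>cube. A (torus_sign s z)) / 2 ^ CARD('n)" by simp
qed

lemma parity_decomposition:
  fixes A :: "'n::finite torus \<Rightarrow> complex"
  assumes "A \<in> Ll1"
  shows "\<exists>a. (\<forall>j\<in>cube. a j \<in> Ll1_down) \<and> A = (\<Sum>j\<in>cube. a j * zpow j)"
proof -
  obtain c where c: "(\<lambda>k. norm (c k)) summable_on UNIV" "A = laurent_series c"
    using assms by (auto simp: Ll1_def)
  define b where "b j = (\<lambda>m. c (m + m + j))" for j
  define a where "a j = (\<lambda>z. laurent_series (b j) (torus_sq z))" for j
  have inj: "inj (\<lambda>m. m + m + j)" for j :: "int ^ 'n"
    by (rule injI) (auto simp: vec_eq_iff)
  have b: "(\<lambda>m. norm (b j m)) summable_on UNIV" for j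
  proof -
    have "(\<lambda>k. norm (c k)) summable_on range (\<lambda>m. m + m + j)"
      using c(1) summable_on_subset_banach by blast
    then show ?thesis
      using summable_on_reindex[OF inj, of "\<lambda>k. norm (c k)"] by (simp add: o_def b_def)
  qed
  have bij: "bij_betw (\<lambda>(j, m). m + m + j) (cube \<times> (UNIV :: (int ^ 'n) set)) UNIV"
  proof (rule bij_betw_byWitness[where f' = "\<lambda>k. (\<chi> i. k $ i mod 2, \<chi> i. k $ i div 2)"])
    show "\<forall>x\<in>cube \<times> (UNIV :: (int ^ 'n) set). (\<lambda>k. (\<chi> i. k $ i mod 2, \<chi> i. k $ i div 2)) ((\<lambda>(j, m). m + m + j) x) = x"
    proof
      fix x :: "(int ^ 'n) \<times> (int ^ 'n)" assume x: "x \<in> cube \<times> UNIV"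
      obtain j m where jm: "x = (j, m)" by (cases x)
      have j: "j $ i = 0 \<or> j $ i = 1" for i using x by (auto simp: jm cube_def)
      have "(m $ i + m $ i + j $ i) mod 2 = j $ i \<and> (m $ i + m $ i + j $ i) div 2 = m $ i" for i
        using j[of i] by presburger
      then show "(\<lambda>k. (\<chi> i. k $ i mod 2, \<chi> i. k $ i div 2)) ((\<lambda>(j, m). m + m + j) x) = x"
        by (simp add: jm vec_eq_iff)
    qed
    show "\<forall>x :: int ^ 'n\<in>UNIV. (\<lambda>(j, m). m + m + j) ((\<chi> i. x $ i mod 2), (\<chi> i. x $ i div 2)) = x"
      by (simp add: vec_eq_iff)
  qed (auto simp: cube_def)
  have "A z = (\<Sum>j\<in>cube. a j z * zpow j z)" for z
  proof -
    let ?f = "\<lambda>k. c k * zpow k z"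
    have s: "?f summable_on UNIV"
      using laurent_summable[OF c(1)] by (rule abs_summable_summable)
    have s': "(\<lambda>x. ?f (case x of (j, m) \<Rightarrow> m + m + j)) summable_on cube \<times> UNIV"
      using s summable_on_reindex_bij_betw[OF bij, of ?f] by simp
    have "A z = infsum ?f UNIV" by (simp add: c(2) laurent_series_def)
    also have "\<dots> = infsum (\<lambda>x. ?f (case x of (j, m) \<Rightarrow> m + m + j)) (cube \<times> UNIV)"
      by (rule infsum_reindex_bij_betw[OF bij, symmetric])
    also have "\<dots> = infsum (\<lambda>j. infsum (\<lambda>m. ?f (m + m + j)) UNIV) cube"
      using infsum_Sigma_banach[OF s'] by simp
    also have "\<dots> = (\<Sum>j\<in>cube. infsum (\<lambda>m. ?f (m + m + j)) UNIV)"
      by (simp add: finite_cube)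
    also have "\<dots> = (\<Sum>j\<in>cube. infsum (\<lambda>m. (b j m * zpow m (torus_sq z)) * zpow j z) UNIV)"
      by (simp add: b_def zpow_sq zpow_add mult_ac)
    also have "\<dots> = (\<Sum>j\<in>cube. a j z * zpow j z)"
      by (simp add: infsum_cmult_left' a_def laurent_series_def)
    finally show ?thesis .
  qed
  then have "A = (\<Sum>j\<in>cube. a j * zpow j)"
    by (intro ext) (simp add: sum_fun_apply)
  moreover have "\<forall>j\<in>cube. a j \<in> Ll1_down"
    using b by (auto simp: a_def Ll1_down_def Ll1_def)
  ultimately show ?thesis by blast
qed

lemma rho_eqI:
  assumes "\<forall>j\<in>cube. a j \<in> Ll1_down" and "A = (\<Sum>j\<in>cube. a j * zpow j)"
  shows "rho A = a 0"
  unfolding rho_def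
proof (rule the_equality)
  show "\<exists>a'. (\<forall>j\<in>cube. a' j \<in> Ll1_down) \<and> A = (\<Sum>j\<in>cube. a' j * zpow j) \<and> a 0 = a' 0"
    using assms by blast
  show "b = a 0" if "\<exists>a'. (\<forall>j\<in>cube. a' j \<in> Ll1_down) \<and> A = (\<Sum>j\<in>cube. a' j * zpow j) \<and> b = a' 0" (is ?P) for b
  proof -
    obtain a' where a': "\<forall>j\<in>cube. a' j \<in> Ll1_down" "A = (\<Sum>j\<in>cube. a' j * zpow j)" "b = a' 0"
      using \<open>?P\<close> by blast
    show "b = a 0"
      using component_0_eq_average[OF assms] component_0_eq_average[OF a'(1,2)] a'(3) by simp
  qed
qed

lemma rho_eq_average:
  fixes A :: "'n::finite torus \<Rightarrow> complex"
  assumes "A \<in> Ll1"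
  shows "rho A = (\<lambda>z. (\<Sum>s\<in>cube. A (torus_sign s z)) / 2 ^ CARD('n))"
proof -
  obtain a where "\<forall>j\<in>cube. a j \<in> Ll1_down" "A = (\<Sum>j\<in>cube. a j * zpow j)"
    using parity_decomposition[OF assms] by blast
  from rho_eqI[OF this] component_0_eq_average[OF this] show ?thesis by simp
qed

end

theory Submission
  imports Defs
begin

text \<open>
  Since \<open>k\<^sub>j\<close> is congruent to \<open>j\<close> modulo 2, the monomials \<open>e\<^sub>j = z\<^bsup>k\<^sub>j\<^esup>\<close> form a basis of the \<open>\<ell>\<^sub>1\<close> series
  over the subring of series in \<open>z\<^sup>2\<close>, orthonormal in the sense that \<open>\<rho>(e\<^sub>i e\<^sub>j\<^sup>-\<^sup>1) = \<delta>\<^sub>i\<^sub>j\<close>. Hence the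
  conjugate of \<open>\<rho>\<^sub>D\<close> is the linear form with coefficients \<open>c\<^sub>j\<close>, the conjugates of \<open>d\<^sub>j\<close>, in this basis.
  As \<open>c\<^sub>0\<close> is a unit, the vectors \<open>c\<^sub>j e\<^sub>0 - c\<^sub>0 e\<^sub>j\<close> form a basis of its kernel, and any vector on which
  the form takes a unit value complements the kernel.
\<close>

section \<open>The kernel of a linear form with a unit coefficient\<close>

text \<open>The ambient ring contains both the vectors and the scalars: \<open>R\<close> is closed
  under the ring operations, \<open>e\<close> is a basis of its span, and \<open>\<phi>\<close> is
  constrained on that span only. Membership of \<open>1\<close> in \<open>R\<close> comes from
  \<open>c o' * v = 1\<close>.\<close>

locale linear_form =
  fixes R :: "'a::comm_ring_1 set" and I :: "'i set" and o' :: 'i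
    and e :: "'i \<Rightarrow> 'a" and c :: "'i \<Rightarrow> 'a" and \<phi> :: "'a \<Rightarrow> 'a" and v :: 'a
  assumes R_0: "0 \<in> R"
    and R_add: "\<And>x y. x \<in> R \<Longrightarrow> y \<in> R \<Longrightarrow> x + y \<in> R"
    and R_mult: "\<And>x y. x \<in> R \<Longrightarrow> y \<in> R \<Longrightarrow> x * y \<in> R"
    and R_minus: "\<And>x. x \<in> R \<Longrightarrow> - x \<in> R"
    and indep: "lin_indep_over R I e"
    and o_in: "o' \<in> I"
    and c_in: "\<And>i. i \<in> I \<Longrightarrow> c i \<in> R"
    and v_in: "v \<in> R" and c_o_v: "c o' * v = 1"
    and \<phi>_eq: "\<And>f. (\<And>i. i \<in> I \<Longrightarrow> f i \<in> R) \<Longrightarrow> \<phi> (\<Sum>i\<in>I. f i * e i) = (\<Sum>i\<in>I. c i * f i)"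
begin

text \<open>These are the Koszul relations between \<open>c o'\<close> and the other coefficients.
  At \<open>i = o'\<close> the value is 0, which leaves this index free for a complementary
  vector.\<close>

definition h :: "'i \<Rightarrow> 'a" where
  "h i = c i * e o' - c o' * e i"

lemma finite_I: "finite I"
  using indep by (simp add: lin_indep_over_def)

lemma R_sum: "(\<And>i. i \<in> J \<Longrightarrow> f i \<in> R) \<Longrightarrow> sum f J \<in> R"
  by (induction J rule: infinite_finite_induct) (auto intro: R_0 R_add)

lemma R_diff: "x \<in> R \<Longrightarrow> y \<in> R \<Longrightarrow> x - y \<in> R"
  using R_add[of x "- y"] R_minus[of y] by simp

lemma sum_split: "sum f I = f o' + sum f (I - {o'})" for f :: "'i \<Rightarrow> 'a"
  using finite_I o_in by (rule sum.remove)

text \<open>Coordinates in the basis \<open>e\<close> of the combination of the \<open>h i\<close>,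
  \<open>i \<noteq> o'\<close>, with coefficients \<open>g i\<close>.\<close>

definition coords :: "('i \<Rightarrow> 'a) \<Rightarrow> 'i \<Rightarrow> 'a" where
  "coords g i = (if i = o' then (\<Sum>j\<in>I - {o'}. g j * c j) else - (g i * c o'))"

lemma coords_in:
  assumes "\<And>i. i \<in> I - {o'} \<Longrightarrow> g i \<in> R" "i \<in> I"
  shows "coords g i \<in> R"
  using assms c_in o_in by (auto simp: coords_def intro!: R_sum R_minus R_mult)

lemma sum_h: "(\<Sum>i\<in>I - {o'}. g i * h i) = (\<Sum>i\<in>I. coords g i * e i)"
proof -
  have "(\<Sum>i\<in>I. coords g i * e i) =
      (\<Sum>j\<in>I - {o'}. g j * c j) * e o' + (\<Sum>i\<in>I - {o'}. - (g i * c o') * e i)"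
    unfolding sum_split by (intro arg_cong2[of _ _ _ _ "(+)"] sum.cong) (auto simp: coords_def)
  also have "\<dots> = (\<Sum>i\<in>I - {o'}. g i * h i)"
    by (simp add: h_def sum_distrib_right right_diff_distrib sum_subtractf sum_negf mult.assoc)
  finally show ?thesis ..
qed

text \<open>Each \<open>g j\<close> contributes \<open>c o' * g j * c j\<close> through the
  coordinate at \<open>o'\<close> and the negative of this through the coordinate at
  \<open>j\<close>, so everything cancels by commutativity.\<close>

lemma \<phi>_h:
  assumes "\<And>i. i \<in> I - {o'} \<Longrightarrow> g i \<in> R"
  shows "\<phi> (\<Sum>i\<in>I - {o'}. g i * h i) = 0"
proof -
  have "\<phi> (\<Sum>i\<in>I - {o'}. g i * h i) = (\<Sum>i\<in>I. c i * coords g i)"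
    unfolding sum_h by (rule \<phi>_eq) (rule coords_in[OF assms])
  also have "\<dots> = c o' * (\<Sum>j\<in>I - {o'}. g j * c j) + (\<Sum>i\<in>I - {o'}. c i * - (g i * c o'))"
    unfolding sum_split by (intro arg_cong2[of _ _ _ _ "(+)"] sum.cong) (auto simp: coords_def)
  also have "\<dots> = 0"
    by (simp add: sum_distrib_left sum.distrib[symmetric] sum_negf algebra_simps)
  finally show ?thesis .
qed

text \<open>Linearity of \<open>\<phi>\<close> over \<open>R\<close>, in the one form that
  complements require: \<open>r = - g o'\<close> adds a multiple of \<open>G\<close>, and
  \<open>r = \<phi> x * u\<close> removes the component along \<open>G\<close>.\<close>

lemma span_diff_scale:
  assumes "x \<in> span_over R I e" "y \<in> span_over R I e" "r \<in> R"
  shows "x - r * y \<in> span_over R I e" and "\<phi> (x - r * y) = \<phi> x - r * \<phi> y"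
proof -
  obtain f g where f: "\<And>i. i \<in> I \<Longrightarrow> f i \<in> R" "x = (\<Sum>i\<in>I. f i * e i)"
    and g: "\<And>i. i \<in> I \<Longrightarrow> g i \<in> R" "y = (\<Sum>i\<in>I. g i * e i)"
    using assms by (auto simp: span_over_def)
  have xy: "x - r * y = (\<Sum>i\<in>I. (f i - r * g i) * e i)"
    by (simp add: f g sum_distrib_left sum_subtractf algebra_simps)
  have R: "f i - r * g i \<in> R" if "i \<in> I" for i
    using that f(1) g(1) assms(3) by (intro R_diff R_mult)
  show "x - r * y \<in> span_over R I e"
    unfolding span_over_def
    by (intro CollectI exI[of _ "\<lambda>i. f i - r * g i"]) (use xy R in simp)
  have "\<phi> (x - r * y) = (\<Sum>i\<in>I. c i * (f i - r * g i))"
    unfolding xy by (rule \<phi>_eq) (rule R)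
  also have "\<dots> = (\<Sum>i\<in>I. c i * f i) - r * (\<Sum>i\<in>I. c i * g i)"
    by (simp add: sum_distrib_left sum_subtractf algebra_simps)
  also have "\<dots> = \<phi> x - r * \<phi> y"
    using \<phi>_eq[of f] \<phi>_eq[of g] f g by simp
  finally show "\<phi> (x - r * y) = \<phi> x - r * \<phi> y" .
qed

lemma h_in_kernel:
  assumes "i \<in> I - {o'}"
  shows "h i \<in> span_over R I e" and "\<phi> (h i) = 0"
proof -
  \<comment> \<open>\<open>c o' * v\<close> plays the role of \<open>1 \<in> R\<close>\<close>
  let ?g = "\<lambda>j. if j = i then c o' * v else 0"
  have g: "?g j \<in> R" for j
    using o_in by (auto intro: R_0 R_mult c_in v_in)
  have eq: "h i = (\<Sum>j\<in>I - {o'}. ?g j * h j)"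
    using assms finite_I by (simp add: c_o_v if_distrib[of "\<lambda>x. x * _"] cong: if_cong)
  show "h i \<in> span_over R I e"
    unfolding eq sum_h span_over_def using coords_in[of ?g, OF g] by blast
  show "\<phi> (h i) = 0"
    unfolding eq by (rule \<phi>_h) (rule g)
qed

text \<open>The coordinate of a combination at \<open>i \<noteq> o'\<close> is
  \<open>- (g i * c o')\<close>. If it vanishes, multiplication by \<open>v\<close> cancels the unit
  \<open>c o'\<close>.\<close>

lemma lin_indep_h: "lin_indep_over R (I - {o'}) h"
  unfolding lin_indep_over_def
proof (intro conjI allI impI ballI)
  show "finite (I - {o'})" using finite_I by simp
  fix g i assume g: "(\<forall>i\<in>I - {o'}. g i \<in> R) \<and> (\<Sum>i\<in>I - {o'}. g i * h i) = 0"
    and i: "i \<in> I - {o'}"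
  have "\<forall>i\<in>I. coords g i = 0"
    using indep g coords_in[of g] unfolding lin_indep_over_def sum_h by blast
  then have "g i * c o' = 0" using i by (auto simp: coords_def dest: bspec[of _ _ i])
  then have "g i * (c o' * v) = 0" by (simp add: mult.assoc[symmetric])
  then show "g i = 0" by (simp add: c_o_v)
qed

text \<open>As \<open>c o'\<close> is a unit, the equation \<open>\<phi> x = 0\<close> determines
  the coordinate of \<open>x\<close> at \<open>o'\<close> from the others, so it suffices to match
  the coordinates away from \<open>o'\<close>.\<close>

lemma basis_kernel: "basis_over R {x \<in> span_over R I e. \<phi> x = 0} (I - {o'}) h"
  unfolding basis_over_def
proof (intro conjI lin_indep_h equalityI subsetI)
  fix x assume "x \<in> span_over R (I - {o'}) h"
  then obtain g where g: "\<And>i. i \<in> I - {o'} \<Longrightarrow> g i \<in> R" "x = (\<Sum>i\<in>I - {o'}. g i * h i)"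
    by (auto simp: span_over_def)
  have "x \<in> span_over R I e"
    unfolding g(2) sum_h span_over_def using coords_in[of g, OF g(1)] by blast
  moreover have "\<phi> x = 0" unfolding g(2) by (rule \<phi>_h) (rule g(1))
  ultimately show "x \<in> {x \<in> span_over R I e. \<phi> x = 0}" by simp
next
  fix x assume "x \<in> {x \<in> span_over R I e. \<phi> x = 0}"
  then obtain f where f: "\<And>i. i \<in> I \<Longrightarrow> f i \<in> R" "x = (\<Sum>i\<in>I. f i * e i)" and "\<phi> x = 0"
    by (auto simp: span_over_def)
  then have "(\<Sum>i\<in>I. c i * f i) = 0" using \<phi>_eq[of f] by simp
  then have f_o: "c o' * f o' = - (\<Sum>i\<in>I - {o'}. c i * f i)"
    unfolding sum_split by (simp add: eq_neg_iff_add_eq_0)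
  \<comment> \<open>Forced by the requirement \<open>- (g i * c o') = f i\<close> for
    \<open>i \<noteq> o'\<close>; the coordinate at \<open>o'\<close> then agrees because of
    \<open>f_o\<close>.\<close>
  define g where "g i = - (v * f i)" for i
  have "coords g i = f i" if "i \<in> I" for i
  proof (cases "i = o'")
    case True
    have "coords g i = v * - (\<Sum>i\<in>I - {o'}. c i * f i)"
      by (simp add: coords_def True g_def sum_distrib_left sum_negf algebra_simps)
    also have "\<dots> = (c o' * v) * f o'"
      unfolding f_o[symmetric] by (simp add: algebra_simps)
    finally show ?thesis by (simp add: c_o_v True)
  next
    case False
    then have "coords g i = (c o' * v) * f i" by (simp add: coords_def g_def algebra_simps)
    then show ?thesis by (simp add: c_o_v)
  qed
  then have "x = (\<Sum>i\<in>I - {o'}. g i * h i)" unfolding sum_h f(2) by simp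
  moreover have "g i \<in> R" if "i \<in> I" for i
    unfolding g_def using that by (intro R_minus R_mult v_in f(1))
  ultimately show "x \<in> span_over R (I - {o'}) h" unfolding span_over_def by blast
qed

text \<open>If \<open>\<phi> G\<close> has inverse \<open>u\<close>, every \<open>x\<close> splits
  as \<open>\<phi> x * u * G\<close> plus an element of the kernel, and the multiple of
  \<open>G\<close> is determined by applying \<open>\<phi>\<close>. The vector \<open>G\<close>
  takes the free slot \<open>o'\<close>.\<close>

lemma basis_complement:
  assumes G: "G \<in> span_over R I e" and u: "u \<in> R" "\<phi> G * u = 1"
  shows "basis_over R (span_over R I e) I (h(o' := G))"
proof -
  have split: "(\<Sum>i\<in>I. g i * (h(o' := G)) i) = g o' * G + (\<Sum>i\<in>I - {o'}. g i * h i)" for g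
    unfolding sum_split by (intro arg_cong2[of _ _ _ _ "(+)"] sum.cong) auto
  have ker: "x \<in> span_over R I e \<and> \<phi> x = 0 \<longleftrightarrow> x \<in> span_over R (I - {o'}) h" for x
    using basis_kernel by (auto simp: basis_over_def)
  have span: "g o' * G + (\<Sum>i\<in>I - {o'}. g i * h i) \<in> span_over R I e"
      and \<phi>_split: "\<phi> (g o' * G + (\<Sum>i\<in>I - {o'}. g i * h i)) = g o' * \<phi> G"
    if g: "\<forall>i\<in>I. g i \<in> R" for g
  proof -
    let ?x = "\<Sum>i\<in>I - {o'}. g i * h i"
    have "?x \<in> span_over R (I - {o'}) h" using g by (auto simp: span_over_def)
    then have x: "?x \<in> span_over R I e" "\<phi> ?x = 0" using ker by blast+
    have "- g o' \<in> R" using g o_in by (auto intro: R_minus)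
    from span_diff_scale[OF x(1) G this] x(2)
    show "g o' * G + ?x \<in> span_over R I e" "\<phi> (g o' * G + ?x) = g o' * \<phi> G"
      by (simp_all add: add.commute)
  qed
  have "lin_indep_over R I (h(o' := G))"
    unfolding lin_indep_over_def
  proof (intro conjI finite_I allI impI)
    fix g assume g: "(\<forall>i\<in>I. g i \<in> R) \<and> (\<Sum>i\<in>I. g i * (h(o' := G)) i) = 0"
    \<comment> \<open>Applying \<open>\<phi>\<close> to the relation kills the combination of the
      \<open>h i\<close> and isolates the coefficient of \<open>G\<close>.\<close>
    then have "\<phi> 0 = g o' * \<phi> G" using \<phi>_split[of g] unfolding split by simp
    moreover have "\<phi> 0 = 0" using \<phi>_eq[of "\<lambda>_. 0"] R_0 by simp
    ultimately have "g o' * (\<phi> G * u) = 0" by (simp add: mult.assoc[symmetric])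
    then have "g o' = 0" by (simp add: u)
    moreover from this have "(\<Sum>i\<in>I - {o'}. g i * h i) = 0" using g unfolding split by simp
    ultimately show "\<forall>i\<in>I. g i = 0"
      using lin_indep_h g unfolding lin_indep_over_def by (metis Diff_iff singletonD)
  qed
  moreover have "span_over R I (h(o' := G)) = span_over R I e"
  proof (intro equalityI subsetI)
    fix x assume "x \<in> span_over R I (h(o' := G))"
    then obtain g where "\<forall>i\<in>I. g i \<in> R" "x = (\<Sum>i\<in>I. g i * (h(o' := G)) i)"
      by (auto simp: span_over_def)
    then show "x \<in> span_over R I e" using span[of g] unfolding split by simp
  next
    fix x assume x: "x \<in> span_over R I e"
    have "\<phi> x \<in> R"
      using x by (auto simp: span_over_def \<phi>_eq intro!: R_sum R_mult c_in)
    then have r: "\<phi> x * u \<in> R" using u by (intro R_mult)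
    have "\<phi> (x - \<phi> x * u * G) = \<phi> x - \<phi> x * (\<phi> G * u)"
      using span_diff_scale(2)[OF x G r] by (simp add: algebra_simps)
    then have "x - \<phi> x * u * G \<in> span_over R (I - {o'}) h"
      using span_diff_scale(1)[OF x G r] by (simp add: ker[symmetric] u)
    then obtain g where g: "\<forall>i\<in>I - {o'}. g i \<in> R" "x - \<phi> x * u * G = (\<Sum>i\<in>I - {o'}. g i * h i)"
      by (auto simp: span_over_def)
    let ?g = "g(o' := \<phi> x * u)"
    have "(\<Sum>i\<in>I. ?g i * (h(o' := G)) i) = \<phi> x * u * G + (\<Sum>i\<in>I - {o'}. g i * h i)"
      unfolding split by (intro arg_cong2[of _ _ _ _ "(+)"] sum.cong) auto
    then have "x = (\<Sum>i\<in>I. ?g i * (h(o' := G)) i)"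
      unfolding g(2)[symmetric] by simp
    moreover have "\<forall>i\<in>I. ?g i \<in> R" using g(1) r by simp
    ultimately show "x \<in> span_over R I (h(o' := G))" unfolding span_over_def by blast
  qed
  ultimately show ?thesis by (simp add: basis_over_def)
qed

end

section \<open>Absolutely convergent Laurent series\<close>

text \<open>
  Repeated exponents are allowed, so that products (indexed by pairs), conjugates and the substitution
  of \<open>z\<^sup>2\<close> are all instances.
\<close>

lemma Ll1_family:
  fixes \<kappa> :: "'i \<Rightarrow> int ^ 'n::finite" and c :: "'i \<Rightarrow> complex"
  assumes c: "(\<lambda>i. norm (c i)) summable_on UNIV"
  shows "(\<lambda>z. \<Sum>\<^sub>\<infinity>i. c i * zpow (\<kappa> i) z) \<in> Ll1"
proof -
  \<comment> \<open>\<open>S\<close> is the disjoint union of the fibres of \<open>\<kappa>\<close>.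
    Fubini on \<open>S\<close> regroups the series by exponent, and \<open>a m\<close> collects all
    coefficients with exponent \<open>m\<close>.\<close>
  define S where "S = (SIGMA m:UNIV. {i. \<kappa> i = m})"
  define a where "a m = infsum c {i. \<kappa> i = m}" for m
  have bij: "bij_betw snd S UNIV"
    by (rule bij_betw_byWitness[where f' = "\<lambda>i. (\<kappa> i, i)"]) (auto simp: S_def)
  have "(\<lambda>x. norm (c (snd x))) summable_on S"
    using c summable_on_reindex_bij_betw[OF bij, of "\<lambda>i. norm (c i)"] by simp
  then have fibre: "(\<lambda>i. norm (c i)) summable_on {i. \<kappa> i = m}"
    and total: "(\<lambda>m. norm (infsum (\<lambda>i. norm (c i)) {i. \<kappa> i = m})) summable_on UNIV" for m
    unfolding S_def Infinite_Sum.abs_summable_on_Sigma_iff by auto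
  have a: "(\<lambda>m. norm (a m)) summable_on UNIV"
  proof (rule Infinite_Sum.abs_summable_on_comparison_test[OF total])
    fix m
    have "norm (a m) \<le> infsum (\<lambda>i. norm (c i)) {i. \<kappa> i = m}"
      unfolding a_def by (rule norm_infsum_bound[OF fibre])
    then show "norm (a m) \<le> norm (infsum (\<lambda>i. norm (c i)) {i. \<kappa> i = m})" by simp
  qed
  have "(\<Sum>\<^sub>\<infinity>i. c i * zpow (\<kappa> i) z) = laurent_series a z" for z
  proof -
    let ?f = "\<lambda>i. c i * zpow (\<kappa> i) z"
    have "?f summable_on UNIV"
      by (rule abs_summable_summable) (use c in \<open>simp add: norm_mult\<close>)
    then have s: "(\<lambda>x. ?f (snd x)) summable_on S"
      using summable_on_reindex_bij_betw[OF bij, of ?f] by simp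
    have "infsum ?f UNIV = infsum (\<lambda>x. ?f (snd x)) S"
      by (rule infsum_reindex_bij_betw[OF bij, symmetric])
    also have "\<dots> = (\<Sum>\<^sub>\<infinity>m. infsum ?f {i. \<kappa> i = m})"
      using infsum_Sigma_banach[OF s[unfolded S_def]] by (simp add: S_def)
    also have "\<dots> = (\<Sum>\<^sub>\<infinity>m. infsum (\<lambda>i. c i * zpow m z) {i. \<kappa> i = m})"
      by (intro infsum_cong) auto
    also have "\<dots> = laurent_series a z"
      by (simp add: infsum_cmult_left' laurent_series_def a_def)
    finally show ?thesis .
  qed
  then show ?thesis using a unfolding Ll1_def by blast
qed

lemma Ll1E:
  assumes "F \<in> Ll1"
  obtains a where "(\<lambda>k. norm (a k)) summable_on UNIV" "F = (\<lambda>z. \<Sum>\<^sub>\<infinity>k. a k * zpow k z)"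
  using assms by (auto simp: Ll1_def laurent_series_def)

lemma LP_subset_Ll1: "LP \<subseteq> Ll1"
proof
  fix F :: "'n::finite torus \<Rightarrow> complex" assume "F \<in> LP"
  then obtain M a where M: "finite M" and F: "F = (\<lambda>z. \<Sum>k\<in>M. a k * zpow k z)"
    by (auto simp: LP_def)
  let ?b = "\<lambda>k. if k \<in> M then a k else 0"
  have "(\<lambda>k. norm (?b k)) summable_on UNIV"
    using M summable_on_cong_neutral[of M UNIV "\<lambda>k. norm (?b k)" "\<lambda>k. norm (?b k)"] by simp
  then have "(\<lambda>z. \<Sum>\<^sub>\<infinity>k. ?b k * zpow k z) \<in> Ll1" by (rule Ll1_family)
  moreover have "(\<Sum>\<^sub>\<infinity>k. ?b k * zpow k z) = F z" for z
    using M infsum_cong_neutral[of M UNIV "\<lambda>k. a k * zpow k z" "\<lambda>k. ?b k * zpow k z"]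
    by (simp add: F)
  ultimately show "F \<in> Ll1" by simp
qed

lemma zpow_LP: "zpow k \<in> LP"
  unfolding LP_def by (auto intro!: exI[of _ "{k}"] exI[of _ "\<lambda>_. 1"])

lemma zpow_Ll1: "zpow k \<in> Ll1"
  using zpow_LP LP_subset_Ll1 by blast

lemma const_Ll1: "(\<lambda>_. x) \<in> Ll1"
  by (rule subsetD[OF LP_subset_Ll1])
    (auto simp: LP_def zpow_0 intro!: exI[of _ "{0}"] exI[of _ "\<lambda>_. x"])

lemma zero_Ll1: "0 \<in> Ll1"
  using const_Ll1[of 0] by (simp add: zero_fun_def)

lemma add_Ll1:
  assumes "F \<in> Ll1" "G \<in> Ll1"
  shows "F + G \<in> Ll1"
proof -
  obtain a b where a: "(\<lambda>k. norm (a k)) summable_on UNIV" "F = (\<lambda>z. \<Sum>\<^sub>\<infinity>k. a k * zpow k z)"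
    and b: "(\<lambda>k. norm (b k)) summable_on UNIV" "G = (\<lambda>z. \<Sum>\<^sub>\<infinity>k. b k * zpow k z)"
    using assms by (auto elim!: Ll1E)
  have "(\<lambda>k. norm (a k + b k)) summable_on UNIV"
    by (rule Infinite_Sum.abs_summable_on_comparison_test'[OF summable_on_add[OF a(1) b(1)]])
      (rule norm_triangle_ineq)
  then have "(\<lambda>z. \<Sum>\<^sub>\<infinity>k. (a k + b k) * zpow k z) \<in> Ll1" by (rule Ll1_family)
  also have "(\<lambda>z. \<Sum>\<^sub>\<infinity>k. (a k + b k) * zpow k z) = F + G"
    unfolding a(2) b(2) fun_eq_iff
    by (simp add: distrib_right infsum_add abs_summable_summable laurent_summable a(1) b(1))
  finally show ?thesis .
qed

text \<open>The product is the series indexed by pairs \<open>(k, l)\<close> with exponent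
  \<open>k + l\<close>. Its absolute convergence follows from that of both factors, and
  \<open>Ll1_family\<close> performs the convolution.\<close>

lemma mult_Ll1:
  assumes "F \<in> Ll1" "G \<in> Ll1"
  shows "F * G \<in> Ll1"
proof -
  obtain a b where a: "(\<lambda>k. norm (a k)) summable_on UNIV" "F = (\<lambda>z. \<Sum>\<^sub>\<infinity>k. a k * zpow k z)"
    and b: "(\<lambda>k. norm (b k)) summable_on UNIV" "G = (\<lambda>z. \<Sum>\<^sub>\<infinity>k. b k * zpow k z)"
    using assms by (auto elim!: Ll1E)
  let ?c = "\<lambda>(k, l). a k * b l" and ?\<kappa> = "\<lambda>(k, l). k + l"
  have c: "(\<lambda>p. norm (?c p)) summable_on UNIV \<times> UNIV"
    unfolding Infinite_Sum.abs_summable_on_Sigma_iff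
    by (auto simp: norm_mult infsum_cmult_right' infsum_nonneg abs_mult
        intro!: summable_on_cmult_right summable_on_cmult_left a(1) b(1))
  then have "(\<lambda>z. \<Sum>\<^sub>\<infinity>p. ?c p * zpow (?\<kappa> p) z) \<in> Ll1" by (intro Ll1_family) simp
  moreover have "(\<Sum>\<^sub>\<infinity>p. ?c p * zpow (?\<kappa> p) z) = (F * G) z" for z
  proof -
    let ?f = "\<lambda>p. ?c p * zpow (?\<kappa> p) z"
    have "?f summable_on UNIV \<times> UNIV"
      by (rule abs_summable_summable) (use c in \<open>simp add: norm_mult\<close>)
    from infsum_Sigma_banach[OF this]
    have "infsum ?f UNIV = (\<Sum>\<^sub>\<infinity>k. \<Sum>\<^sub>\<infinity>l. (a k * zpow k z) * (b l * zpow l z))"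
      by (simp add: zpow_add mult_ac)
    also have "\<dots> = F z * G z"
      by (simp add: a(2) b(2) infsum_cmult_left' infsum_cmult_right')
    finally show ?thesis by simp
  qed
  ultimately show ?thesis by (simp add: times_fun_def)
qed

lemma uminus_Ll1: "F \<in> Ll1 \<Longrightarrow> - F \<in> Ll1"
  using mult_Ll1[OF const_Ll1[of "- 1"]] by (simp add: times_fun_def fun_Compl_def)

lemma cnj_Ll1:
  assumes "F \<in> Ll1"
  shows "(\<lambda>z. cnj (F z)) \<in> Ll1"
proof -
  obtain a where a: "(\<lambda>k. norm (a k)) summable_on UNIV" "F = (\<lambda>z. \<Sum>\<^sub>\<infinity>k. a k * zpow k z)"
    using assms by (rule Ll1E)
  have "(\<lambda>z. \<Sum>\<^sub>\<infinity>k. cnj (a k) * zpow (- k) z) \<in> Ll1" using a(1) by (intro Ll1_family) simp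
  also have "(\<lambda>z. \<Sum>\<^sub>\<infinity>k. cnj (a k) * zpow (- k) z) = (\<lambda>z. cnj (F z))"
    by (simp add: a(2) infsum_cnj[symmetric] cnj_zpow del: infsum_cnj)
  finally show ?thesis .
qed

section \<open>The subring of series in the squared variables\<close>

lemma Ll1_downI: "G \<in> Ll1 \<Longrightarrow> (\<lambda>z. G (torus_sq z)) \<in> Ll1_down"
  by (auto simp: Ll1_down_def)

lemma Ll1_down_subset: "Ll1_down \<subseteq> Ll1"
proof
  fix F :: "'n::finite torus \<Rightarrow> complex" assume "F \<in> Ll1_down"
  then obtain a where "(\<lambda>k. norm (a k)) summable_on UNIV"
    and "F = (\<lambda>z. \<Sum>\<^sub>\<infinity>k. a k * zpow k (torus_sq z))"
    by (auto simp: Ll1_down_def elim!: Ll1E)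
  then show "F \<in> Ll1" by (simp add: zpow_sq Ll1_family)
qed

lemma LP_down_subset: "LP_down \<subseteq> Ll1_down"
  using LP_subset_Ll1 by (auto simp: LP_down_def Ll1_down_def)

lemma zpow_double_Ll1_down: "zpow (m + m) \<in> Ll1_down"
  using Ll1_downI[OF zpow_Ll1[of m]] by (simp add: zpow_sq)

lemma zero_Ll1_down: "0 \<in> Ll1_down"
  using Ll1_downI[OF zero_Ll1] by (simp add: zero_fun_def)

lemma Ll1_downE:
  assumes "F \<in> Ll1_down"
  obtains G where "G \<in> Ll1" "F = (\<lambda>z. G (torus_sq z))"
  using assms by (auto simp: Ll1_down_def)

lemma add_Ll1_down: "F \<in> Ll1_down \<Longrightarrow> G \<in> Ll1_down \<Longrightarrow> F + G \<in> Ll1_down"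
  by (elim Ll1_downE) (simp add: plus_fun_def Ll1_downI[OF add_Ll1, unfolded plus_fun_def])

lemma mult_Ll1_down: "F \<in> Ll1_down \<Longrightarrow> G \<in> Ll1_down \<Longrightarrow> F * G \<in> Ll1_down"
  by (elim Ll1_downE) (simp add: times_fun_def Ll1_downI[OF mult_Ll1, unfolded times_fun_def])

lemma uminus_Ll1_down: "F \<in> Ll1_down \<Longrightarrow> - F \<in> Ll1_down"
  by (elim Ll1_downE) (simp add: fun_Compl_def Ll1_downI[OF uminus_Ll1, unfolded fun_Compl_def])

lemma cnj_Ll1_down: "F \<in> Ll1_down \<Longrightarrow> (\<lambda>z. cnj (F z)) \<in> Ll1_down"
  by (elim Ll1_downE) (simp add: Ll1_downI[OF cnj_Ll1])

lemma sum_Ll1: "(\<And>i. i \<in> I \<Longrightarrow> f i \<in> Ll1) \<Longrightarrow> sum f I \<in> Ll1"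
  by (induction I rule: infinite_finite_induct) (auto intro: zero_Ll1 add_Ll1)

section \<open>Averaging over signs\<close>

text \<open>Orthogonality of characters for arbitrary exponents: the sum factors over the
  coordinates, and the factor \<open>(- 1) powi (m $ i) + 1\<close> vanishes as soon as
  \<open>m $ i\<close> is odd.\<close>

lemma sum_cube_zpow_sign:
  fixes m :: "int ^ 'n::finite"
  shows "(\<Sum>s\<in>cube. zpow m (torus_sign s z)) = (if \<forall>i. even (m $ i) then 2 ^ CARD('n) * zpow m z else 0)"
proof -
  have "(\<Sum>s\<in>cube. zpow m (torus_sign s z)) =
      (\<Sum>s\<in>cube. \<Prod>i\<in>UNIV. ((- 1 :: complex) powi (m $ i)) powi (s $ i)) * zpow m z"
    by (simp add: zpow_sign sum_distrib_left power_int_mult[symmetric] mult.commute)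
  also have "\<dots> = (\<Prod>i\<in>UNIV. (- 1 :: complex) powi (m $ i) + 1) * zpow m z"
    by (simp only: sum_cube_prod)
  also have "\<dots> = (if \<forall>i. even (m $ i) then 2 ^ CARD('n) * zpow m z else 0)"
  proof (cases "\<forall>i. even (m $ i)")
    case False
    then obtain i where "odd (m $ i)" by blast
    then have "\<exists>i. (- 1 :: complex) powi (m $ i) + 1 = 0" by (intro exI[of _ i]) simp
    then show ?thesis using False by simp
  qed simp
  finally show ?thesis .
qed

lemma rho_cnj:
  assumes "A \<in> Ll1"
  shows "rho (\<lambda>z. cnj (A z)) = (\<lambda>z. cnj (rho A z))"
  by (simp add: rho_eq_average assms cnj_Ll1)

lemma rho_sum:
  fixes A :: "'i \<Rightarrow> 'n::finite torus \<Rightarrow> complex"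
  assumes "\<And>i. i \<in> I \<Longrightarrow> A i \<in> Ll1"
  shows "rho (\<Sum>i\<in>I. A i) = (\<Sum>i\<in>I. rho (A i))"
proof (rule ext)
  fix z
  have "rho (\<Sum>i\<in>I. A i) z = (\<Sum>s\<in>cube. \<Sum>i\<in>I. A i (torus_sign s z)) / 2 ^ CARD('n)"
    by (simp add: rho_eq_average sum_Ll1 assms sum_fun_apply)
  also have "\<dots> = (\<Sum>i\<in>I. (\<Sum>s\<in>cube. A i (torus_sign s z)) / 2 ^ CARD('n))"
    by (subst sum.swap) (simp add: sum_divide_distrib)
  also have "\<dots> = (\<Sum>i\<in>I. rho (A i)) z"
    by (simp add: sum_fun_apply rho_eq_average assms)
  finally show "rho (\<Sum>i\<in>I. A i) z = (\<Sum>i\<in>I. rho (A i)) z" .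
qed

text \<open>Series in the squared variables are invariant under sign changes, so they factor out of
  the average.\<close>

lemma rho_mult_left:
  assumes "f \<in> Ll1_down" "A \<in> Ll1"
  shows "rho (f * A) = f * rho A"
proof -
  have "f * A \<in> Ll1" using assms Ll1_down_subset by (blast intro: mult_Ll1)
  then show ?thesis using assms
    by (simp add: rho_eq_average fun_eq_iff Ll1_down_sign sum_distrib_left[symmetric])
qed

section \<open>Monomials with prescribed parities as a basis\<close>

lemma parity_unique:
  fixes m j :: "int ^ 'n::finite"
  assumes "u \<in> Ll1_down" "u \<noteq> 0" "P \<in> Ll1_down" and eq: "u * zpow m = P * zpow j"
  shows "even (m $ i - j $ i)"
proof -
  obtain z where z: "u z \<noteq> 0" using assms(2) by (auto simp: fun_eq_iff)
  \<comment> \<open>Changing the sign of the coordinate \<open>i\<close> alone fixes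
    \<open>u\<close> and \<open>P\<close> and multiplies the two monomials by
    \<open>(- 1) powi (m $ i)\<close> and \<open>(- 1) powi (j $ i)\<close>. At a point where
    \<open>u\<close> is nonzero these signs must agree.\<close>
  define s :: "int ^ 'n" where "s = (\<chi> t. if t = i then 1 else 0)"
  have sgn: "zpow l (torus_sign s z) = (- 1) powi (l $ i) * zpow l z" for l
  proof -
    have "(\<Prod>t\<in>UNIV. ((- 1 :: complex) powi (s $ t)) powi (l $ t)) =
        (\<Prod>t\<in>UNIV. if t = i then (- 1) powi (l $ t) else 1)"
      by (intro prod.cong) (auto simp: s_def)
    then show ?thesis by (simp add: zpow_sign)
  qed
  have eq': "u w * zpow m w = P w * zpow j w" for w
    using fun_cong[OF eq, of w] by simp
  have "u z * zpow m z * (- 1) powi (m $ i) = P z * zpow j z * (- 1) powi (j $ i)"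
    using eq'[of "torus_sign s z"] assms(1,3) by (simp only: sgn Ll1_down_sign mult_ac)
  then have "u z * zpow m z * (- 1) powi (m $ i) = u z * zpow m z * (- 1) powi (j $ i)"
    by (simp only: eq'[of z, symmetric])
  moreover have "zpow m z \<noteq> 0" using norm_zpow[of m z] by (metis norm_zero zero_neq_one)
  ultimately have "(- 1 :: complex) powi (m $ i) = (- 1) powi (j $ i)" using z by simp
  then show ?thesis by (cases "even (m $ i)"; cases "even (j $ i)") auto
qed

text \<open>The monomials are orthonormal: entries of cube elements are 0 or 1, so
  \<open>k j - k l\<close> has only even entries exactly when \<open>j = l\<close>. Hence
  \<open>rho\<close> reads off a single coordinate.\<close>

lemma rho_coefficient:
  fixes k :: "int ^ 'n::finite \<Rightarrow> int ^ 'n"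
  assumes f: "\<And>j. j \<in> cube \<Longrightarrow> f j \<in> Ll1_down"
    and k: "\<And>j i. j \<in> cube \<Longrightarrow> even (k j $ i - j $ i)"
    and l: "l \<in> cube"
  shows "rho ((\<Sum>j\<in>cube. f j * zpow (k j)) * zpow (- k l)) = f l"
proof -
  have one: "rho (zpow (k j - k l)) = (if j = l then 1 else 0)" if j: "j \<in> cube" for j
  proof -
    have "even (k j $ i - k l $ i) \<longleftrightarrow> j $ i = l $ i" for i
    proof -
      have "j $ i \<in> {0, 1}" "l $ i \<in> {0, 1}" using j l by (auto simp: cube_def)
      then show ?thesis using k[OF j, of i] k[OF l, of i] by auto
    qed
    then have "(\<forall>i. even ((k j - k l) $ i)) \<longleftrightarrow> j = l" by (simp add: vec_eq_iff)
    then show ?thesis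
      by (simp add: rho_eq_average zpow_Ll1 sum_cube_zpow_sign zpow_0 fun_eq_iff)
  qed
  have "(\<Sum>j\<in>cube. f j * zpow (k j)) * zpow (- k l) = (\<Sum>j\<in>cube. f j * zpow (k j - k l))"
    by (simp add: fun_eq_iff sum_fun_apply sum_distrib_right mult.assoc zpow_add[symmetric])
  then have "rho ((\<Sum>j\<in>cube. f j * zpow (k j)) * zpow (- k l)) =
      rho (\<Sum>j\<in>cube. f j * zpow (k j - k l))" by simp
  also have "\<dots> = (\<Sum>j\<in>cube. f j * rho (zpow (k j - k l)))"
    using f Ll1_down_subset by (subst rho_sum) (auto simp: rho_mult_left zpow_Ll1 intro!: mult_Ll1)
  also have "\<dots> = (\<Sum>j\<in>cube. if j = l then f l else 0)"
    by (intro sum.cong) (auto simp: one)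
  also have "\<dots> = f l" using l by (simp add: finite_cube)
  finally show ?thesis .
qed

text \<open>Each parity component is rewritten by
  \<open>zpow j = zpow (j - k j) * zpow (k j)\<close>, where \<open>j - k j\<close> is even and so
  the first factor is a scalar.\<close>

lemma zpow_span:
  fixes k :: "int ^ 'n::finite \<Rightarrow> int ^ 'n"
  assumes k: "\<And>j i. j \<in> cube \<Longrightarrow> even (k j $ i - j $ i)"
  shows "span_over Ll1_down cube (\<lambda>j. zpow (k j)) = Ll1"
proof (intro equalityI subsetI)
  fix F assume "F \<in> span_over Ll1_down cube (\<lambda>j. zpow (k j))"
  then show "F \<in> Ll1"
    using Ll1_down_subset by (auto simp: span_over_def intro!: sum_Ll1 mult_Ll1 zpow_Ll1)
next
  fix F :: "'n torus \<Rightarrow> complex" assume "F \<in> Ll1"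
  then obtain a where a: "\<And>j. j \<in> cube \<Longrightarrow> a j \<in> Ll1_down" "F = (\<Sum>j\<in>cube. a j * zpow j)"
    using parity_decomposition by blast
  have "a j * zpow (j - k j) \<in> Ll1_down" if j: "j \<in> cube" for j
  proof -
    define m :: "int ^ 'n" where "m = (\<chi> i. (j $ i - k j $ i) div 2)"
    have "m $ i + m $ i = j $ i - k j $ i" for i
      using k[OF j, of i] by (simp add: m_def)
    then have "j - k j = m + m" by (simp add: vec_eq_iff)
    then show ?thesis using mult_Ll1_down[OF a(1)[OF j] zpow_double_Ll1_down[of m]] by (simp only:)
  qed
  moreover have "F = (\<Sum>j\<in>cube. a j * zpow (j - k j) * zpow (k j))"
    by (simp add: a(2) fun_eq_iff sum_fun_apply mult.assoc zpow_add[symmetric])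
  ultimately show "F \<in> span_over Ll1_down cube (\<lambda>j. zpow (k j))"
    unfolding span_over_def by (intro CollectI exI[of _ "\<lambda>j. a j * zpow (j - k j)"]) simp
qed

lemma zpow_lin_indep:
  fixes k :: "int ^ 'n::finite \<Rightarrow> int ^ 'n"
  assumes k: "\<And>j i. j \<in> cube \<Longrightarrow> even (k j $ i - j $ i)"
  shows "lin_indep_over Ll1_down cube (\<lambda>j. zpow (k j))"
  unfolding lin_indep_over_def
proof (intro conjI finite_cube allI impI ballI)
  fix f :: "int ^ 'n \<Rightarrow> 'n torus \<Rightarrow> complex" and l :: "int ^ 'n"
  assume f: "(\<forall>j\<in>cube. f j \<in> Ll1_down) \<and> (\<Sum>j\<in>cube. f j * zpow (k j)) = 0" and "l \<in> cube"
  then have "f l = rho (0 * zpow (- k l))" using rho_coefficient[of f k l] k by simp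
  also have "\<dots> = 0" using rho_eq_average[OF zero_Ll1] by (simp add: fun_eq_iff)
  finally show "f l = 0" .
qed

text \<open>For \<open>d j = 0\<close> the membership in \<open>k_parity\<close> says nothing about
  \<open>k j\<close>, so its class modulo 2 is fixed separately. The normalization
  \<open>k 0 = 0\<close> matters for (i): in general \<open>rho (D * D' j)\<close> is
  \<open>d 0 * d j * (zpow (k 0) - 1)\<close>. The families \<open>D'\<close> and \<open>H\<close>
  are prescribed away from 0 only, and in (iv) the index 0 carries the additional
  polynomial.\<close>

theorem proposition4p3:
  fixes d :: "int ^ 'n::finite \<Rightarrow> 'n torus \<Rightarrow> complex"
    and k :: "int ^ 'n \<Rightarrow> int ^ 'n"
    and D :: "'n torus \<Rightarrow> complex"
    and D' H :: "int ^ 'n \<Rightarrow> 'n torus \<Rightarrow> complex"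
  assumes D: "D = (\<Sum>j\<in>cube. d j * zpow (k j))"
    and d_down: "\<And>j. j \<in> cube \<Longrightarrow> d j \<in> LP_down"
    and k_parity: "\<And>j. j \<in> cube \<Longrightarrow> d j * zpow (k j) \<in> {P * zpow j |P. P \<in> LP_down}"
    and k_parity_degenerate:
      "\<And>j. j \<in> cube \<Longrightarrow> d j = 0 \<Longrightarrow> zpow (k j) \<in> {P * zpow j |P. P \<in> LP_down}"
    and k_zero: "k 0 = 0"
    and d0_nonzero: "d 0 \<noteq> 0"
    and d0_invertible: "invertible_in Ll1_down (d 0)"
    and D': "\<And>j. j \<in> cube - {0} \<Longrightarrow> D' j = d j - d 0 * zpow (- k j)"
    and H: "\<And>j. j \<in> cube - {0} \<Longrightarrow> H j = lconj (D' j)"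
  shows "(\<forall>j\<in>cube - {0}. H j = lconj (d j) - lconj (d 0) * zpow (k j))
    \<and> (\<forall>j\<in>cube - {0}. rho (D * D' j) = 0 \<and> rho (lconj D * H j) = 0)
    \<and> lin_indep_over Ll1_down (cube - {0}) H
    \<and> basis_over Ll1_down (Ker_rhoD D) (cube - {0}) H
    \<and> (\<forall>G\<in>LP. invertible_in Ll1_down (rhoD D G) \<longrightarrow>
         basis_over Ll1_down Ll1 cube (H(0 := G)))"
proof -
  have d_in: "d j \<in> Ll1_down" if "j \<in> cube" for j
    using d_down[OF that] LP_down_subset by blast
  have even_k: "even (k j $ i - j $ i)" if j: "j \<in> cube" for j i
  proof (cases "d j = 0")
    case True
    then obtain P where "P \<in> Ll1_down" "zpow (k j) = P * zpow j"
      using k_parity_degenerate[OF j] LP_down_subset by blast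
    then show ?thesis
      using zpow_double_Ll1_down[of 0] by (intro parity_unique[of 1 P]) (simp_all add: zpow_0)
  next
    case False
    then obtain P where "P \<in> Ll1_down" "d j * zpow (k j) = P * zpow j"
      using k_parity[OF j] LP_down_subset by blast
    then show ?thesis using d_in[OF j] False by (intro parity_unique[of "d j" P])
  qed
  define c where "c j = (\<lambda>z. cnj (d j z))" for j
  \<comment> \<open>\<open>rhoD D\<close> is conjugate-linear; its pointwise conjugate
    \<open>\<phi>\<close> is linear over \<open>Ll1_down\<close> and has the same kernel.\<close>
  define \<phi> where "\<phi> F = rho (lconj D * F)" for F
  have c_in: "c j \<in> Ll1_down" if "j \<in> cube" for j
    unfolding c_def using d_in[OF that] by (rule cnj_Ll1_down)
  have c_Ll1: "c j \<in> Ll1" and d_Ll1: "d j \<in> Ll1" if "j \<in> cube" for j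
    using c_in[OF that] d_in[OF that] Ll1_down_subset by blast+
  have lconj_d: "lconj (d j) = c j" if "j \<in> cube" for j
    using d_Ll1[OF that] by (simp add: lconj_eq_cnj c_def)
  have D_Ll1: "D \<in> Ll1"
    unfolding D using d_Ll1 by (intro sum_Ll1 mult_Ll1 zpow_Ll1)
  have lconj_D: "lconj D = (\<lambda>z. cnj (D z))" and lconj_D_Ll1: "lconj D \<in> Ll1"
    using D_Ll1 by (simp_all add: lconj_eq_cnj cnj_Ll1)
  have lconj_D_sum: "lconj D = (\<Sum>j\<in>cube. c j * zpow (- k j))"
    unfolding lconj_D by (simp add: D fun_eq_iff sum_fun_apply c_def cnj_zpow)
  \<comment> \<open>The term \<open>c l * zpow (- k l)\<close> of the conjugate of \<open>D\<close>
    extracts the coordinate \<open>f l\<close> and multiplies it by \<open>c l\<close>.\<close>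
  have \<phi>_expand: "\<phi> (\<Sum>j\<in>cube. f j * zpow (k j)) = (\<Sum>j\<in>cube. c j * f j)"
    if f: "\<And>j. j \<in> cube \<Longrightarrow> f j \<in> Ll1_down" for f
  proof -
    let ?F = "\<Sum>j\<in>cube. f j * zpow (k j)"
    have F: "?F * zpow (- k l) \<in> Ll1" for l
      using f Ll1_down_subset by (intro sum_Ll1 mult_Ll1 zpow_Ll1) blast
    have "lconj D * ?F = (\<Sum>l\<in>cube. c l * (?F * zpow (- k l)))"
      unfolding lconj_D_sum sum_distrib_right[of _ _ ?F]
      by (intro sum.cong refl) (simp only: mult_ac)
    then have "\<phi> ?F = (\<Sum>l\<in>cube. rho (c l * (?F * zpow (- k l))))"
      unfolding \<phi>_def using F c_Ll1 by (simp add: rho_sum mult_Ll1)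
    also have "\<dots> = (\<Sum>l\<in>cube. c l * f l)"
      using F c_in f even_k by (intro sum.cong) (simp_all add: rho_mult_left rho_coefficient)
    finally show ?thesis .
  qed
  obtain v where v: "v \<in> Ll1_down" "d 0 * v = 1"
    using d0_invertible by (auto simp: invertible_in_def)
  interpret linear_form Ll1_down cube 0 "\<lambda>j. zpow (k j)" c \<phi> "\<lambda>z. cnj (v z)"
  proof
    show "c 0 * (\<lambda>z. cnj (v z)) = 1"
      using v(2) by (simp add: fun_eq_iff c_def flip: complex_cnj_mult)
  qed (use zero_Ll1_down add_Ll1_down mult_Ll1_down uminus_Ll1_down zpow_lin_indep[OF even_k]
      zero_in_cube c_in cnj_Ll1_down[OF v(1)] \<phi>_expand in auto)
  have span: "span_over Ll1_down cube (\<lambda>j. zpow (k j)) = Ll1"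
    by (rule zpow_span) (rule even_k)
  have D'_Ll1: "D' j \<in> Ll1" if j: "j \<in> cube - {0}" for j
    using add_Ll1[OF d_Ll1 uminus_Ll1[OF mult_Ll1[OF d_Ll1 zpow_Ll1]], of j 0 "- k j"] j
    by (simp add: D' zero_in_cube)
  have H_eq: "H j = c j - c 0 * zpow (k j)" if j: "j \<in> cube - {0}" for j
  proof -
    have "H j = (\<lambda>z. cnj (D' j z))" using D'_Ll1[OF j] by (simp add: H[OF j] lconj_eq_cnj)
    then show ?thesis by (simp add: D'[OF j] fun_eq_iff c_def cnj_zpow)
  qed
  \<comment> \<open>By \<open>k 0 = 0\<close> the basis vector at index 0 is the constant 1, so
    \<open>c j\<close> equals \<open>c j * zpow (k 0)\<close>.\<close>
  then have H_h: "H j = h j" if "j \<in> cube - {0}" for j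
    using that by (simp only: h_def k_zero zpow_0 mult_1_right)
  have \<phi>_H: "rho (lconj D * H j) = 0" if j: "j \<in> cube - {0}" for j
    using h_in_kernel(2)[OF j] H_h[OF j] by (simp add: \<phi>_def)
  have rhoD_\<phi>: "rhoD D F = (\<lambda>z. cnj (\<phi> F z))" if F: "F \<in> Ll1" for F
  proof -
    have "D * lconj F = (\<lambda>z. cnj ((lconj D * F) z))"
      using F by (simp add: lconj_D lconj_eq_cnj fun_eq_iff)
    then show ?thesis
      by (simp only: rhoD_def \<phi>_def rho_cnj[OF mult_Ll1[OF lconj_D_Ll1 F]])
  qed
  have rho_D': "rho (D * D' j) = 0" if j: "j \<in> cube - {0}" for j
  proof -
    \<comment> \<open>This product is the conjugate of \<open>lconj D * H j\<close>, so the first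
      identity of (i) is the conjugate of the second.\<close>
    have "D * D' j = (\<lambda>z. cnj ((lconj D * H j) z))"
      using D'_Ll1[OF j] by (simp add: lconj_D H[OF j] lconj_eq_cnj fun_eq_iff)
    moreover have "H j \<in> Ll1" using h_in_kernel(1)[OF j] by (simp add: H_h[OF j] span)
    ultimately show ?thesis
      by (simp only: rho_cnj[OF mult_Ll1[OF lconj_D_Ll1]] \<phi>_H[OF j])
        (simp add: fun_eq_iff)
  qed
  \<comment> \<open>\<open>H\<close> and \<open>h\<close> are known to agree only away from 0, so
    transferring bases needs congruence on the index set.\<close>
  have lin_indep_cong: "lin_indep_over R J x = lin_indep_over R J y"
    and basis_cong: "basis_over R N J x = basis_over R N J y"
    if "\<And>j. j \<in> J \<Longrightarrow> x j = y j" for R N and J :: "(int ^ 'n) set"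
      and x y :: "int ^ 'n \<Rightarrow> 'n torus \<Rightarrow> complex"
    using that by (simp_all add: basis_over_def lin_indep_over_def span_over_def cong: sum.cong)
  have ker: "Ker_rhoD D = {F \<in> Ll1. \<phi> F = 0}"
    by (auto simp: Ker_rhoD_def rhoD_\<phi> fun_eq_iff)
  have iv: "basis_over Ll1_down Ll1 cube (H(0 := G))"
    if G: "G \<in> LP" and inv: "invertible_in Ll1_down (rhoD D G)" for G
  proof -
    have G_in: "G \<in> Ll1" using G LP_subset_Ll1 by blast
    obtain u where u: "u \<in> Ll1_down" "rhoD D G * u = 1"
      using inv by (auto simp: invertible_in_def)
    \<comment> \<open>Conjugation turns an inverse of \<open>rhoD D G\<close> into an inverse of
      \<open>\<phi> G\<close>, again in \<open>Ll1_down\<close>.\<close>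
    have "\<phi> G z * cnj (u z) = 1" for z
      using arg_cong[OF fun_cong[OF u(2), of z], of cnj] by (simp add: rhoD_\<phi>[OF G_in])
    then have "\<phi> G * (\<lambda>z. cnj (u z)) = 1" by (simp add: fun_eq_iff)
    from basis_complement[OF _ cnj_Ll1_down[OF u(1)] this] G_in
    have "basis_over Ll1_down Ll1 cube (h(0 := G))" by (simp add: span)
    then show ?thesis
      using basis_cong[of cube "H(0 := G)" "h(0 := G)"] H_h by (auto simp del: fun_upd_apply simp: fun_upd_def)
  qed
  have "lin_indep_over Ll1_down (cube - {0}) H"
    using lin_indep_h lin_indep_cong[of "cube - {0}" H h] H_h by simp
  moreover have "basis_over Ll1_down (Ker_rhoD D) (cube - {0}) H"
    using basis_kernel basis_cong[of "cube - {0}" H h] H_h by (simp add: span ker)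
  ultimately show ?thesis
    using H_eq \<phi>_H rho_D' iv by (simp add: lconj_d zero_in_cube)
qed

end
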